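(* Let $A$ be a real positive-semidefinite matrix of size $n\times n$, let $1\le k\le n$ be an integer, and let $S$ be a real $n\times \ell$ matrix. Let $$A = \begin{bmatrix} U_1 & U_2\end{bmatrix}\begin{bmatrix}\Sigma_1 & \\ & \Sigma_2\end{bmatrix}\begin{bmatrix}U_1^t\\ U_2^t\end{bmatrix}$$ be an eigenvalue decomposition of $A$, where $U_1\in\mathbb{R}^{n\times k}$ and $U_2\in\mathbb{R}^{n\times(n-k)}$ have orthonormal columns that respectively span a dominant $k$-dimensional invariant subspace of $A$ and the corresponding bottom $(n-k)$-dimensional invariant subspace of $A$, and $\Sigma_1$, $\Sigma_2$ are the corresponding diagonal matrices of eigenvalues. Define $\Omega_1 = U_1^tS$ and $\Omega_2 = U_2^tS$, and let $C = AS$ and $W = S^tAS$. Assume $\Omega_1$ has full row rank. Then $$\|A - C W^\dagger C^t\|_2 = \big\|\big(I - P_{A^{1/2}S}\big)A^{1/2}\big\|_2^2 \le \|\Sigma_2\|_2\left(1 + \|\Omega_2\Omega_1^\dagger\|_2^2\right).$$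
   Context: All matrices are real; $\|\cdot\|_2$ is the spectral norm, $(\cdot)^t$ the transpose, and $(\cdot)^\dagger$ the Moore–Penrose pseudoinverse. $A^{1/2}$ is the unique positive-semidefinite square root of $A$. For a matrix $M$, $P_M = MM^\dagger$ is the orthogonal projection onto the column space of $M$. The eigenvalues of $A$ are ordered $\lambda_1(A)\ge\cdots\ge\lambda_n(A)$, counted with multiplicity; thus $\Sigma_1$ has diagonal entries $\lambda_1(A),\dots,\lambda_k(A)$ and $\Sigma_2$ has diagonal entries $\lambda_{k+1}(A),\dots,\lambda_n(A)$, and $[U_1\ U_2]$ is an orthogonal matrix. If $k=n$, the blocks $U_2$, $\Sigma_2$, $\Omega_2$ are empty and their norms are taken to be $0$. The matrix $CW^\dagger C^t$ is called the Nyström extension of $A$ using $S$ as the column sampling matrix. *)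

theory Defs
  imports
    "Jordan_Normal_Form.Char_Poly"
    "Jordan_Normal_Form.DL_Rank"
    "HOL-Library.Multiset"
begin

definition vec_norm2 :: "real vec \<Rightarrow> real" where
  "vec_norm2 v = sqrt (v \<bullet> v)"

definition spectral_norm :: "real mat \<Rightarrow> real" where
  "spectral_norm M =
     (SUP x \<in> {x \<in> carrier_vec (dim_col M). vec_norm2 x \<le> 1}. vec_norm2 (M *\<^sub>v x))"

text \<open>Matrices without rows or without columns have norm 0, so no separate convention is needed for
  empty blocks.\<close>

lemma spectral_norm_empty:
  assumes "dim_row M = 0 \<or> dim_col M = 0"
  shows "spectral_norm M = 0"
proof -
  let ?B = "{x \<in> carrier_vec (dim_col M). vec_norm2 x \<le> 1}"
  have "vec_norm2 (M *\<^sub>v x) = 0" if "x \<in> ?B" for x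
    using assms that by (auto simp: vec_norm2_def scalar_prod_def)
  moreover have "0\<^sub>v (dim_col M) \<in> ?B"
    by (simp add: vec_norm2_def)
  ultimately have "(\<lambda>x. vec_norm2 (M *\<^sub>v x)) ` ?B = {0}"
    by force
  then show ?thesis
    by (simp add: spectral_norm_def)
qed

text \<open>The Moore--Penrose pseudoinverse, as the unique solution of the four Penrose equations.\<close>

definition pinv :: "real mat \<Rightarrow> real mat" where
  "pinv M = (THE X. X \<in> carrier_mat (dim_col M) (dim_row M) \<and>
     M * X * M = M \<and> X * M * X = X \<and> (M * X)\<^sup>T = M * X \<and> (X * M)\<^sup>T = X * M)"

definition col_proj :: "real mat \<Rightarrow> real mat" where
  "col_proj M = M * pinv M"

definition psd :: "nat \<Rightarrow> real mat \<Rightarrow> bool" where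
  "psd n A \<longleftrightarrow> A \<in> carrier_mat n n \<and> A\<^sup>T = A \<and> (\<forall>x \<in> carrier_vec n. 0 \<le> x \<bullet> (A *\<^sub>v x))"

definition psd_sqrt :: "real mat \<Rightarrow> real mat" where
  "psd_sqrt A = (THE B. psd (dim_row A) B \<and> B * B = A)"

text \<open>Real eigenvalues in non-increasing order, repeated by algebraic multiplicity; for a real
  symmetric matrix of size n these are all n eigenvalues.  The list is indexed from 0.\<close>

definition eigenvalues_desc :: "real mat \<Rightarrow> real list" where
  "eigenvalues_desc A = rev (sorted_list_of_multiset (proots (char_poly A)))"

definition append_cols :: "real mat \<Rightarrow> real mat \<Rightarrow> real mat" where
  "append_cols M N = four_block_mat M N (0\<^sub>m 0 (dim_col M)) (0\<^sub>m 0 (dim_col N))"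

end

theory Submission
  imports Defs
begin

text \<open>
  Let \<open>B = A^{1/2}\<close>, \<open>Y = B S\<close> and let \<open>P\<close> be the orthogonal projection onto the column space
  of \<open>Y\<close>.  Since \<open>C = B Y\<close> and \<open>W = Y\<^sup>T Y\<close>, and since \<open>Y\<^sup>\<dagger> = (Y\<^sup>T Y)\<^sup>\<dagger> Y\<^sup>T\<close>
  (\<open>pinv_gram\<close>), the Nystrom extension is \<open>B Y Y\<^sup>\<dagger> B = B P B\<close>.  Its error \<open>B (1 - P) B\<close> is
  the Gram matrix \<open>E\<^sup>T E\<close> of \<open>E = (1 - P) B\<close>, because \<open>1 - P\<close> is a symmetric idempotent
  (\<open>nystrom_residual_gram\<close>).  The equality is then the identity
  \<open>\<parallel>E\<^sup>T E\<parallel> = \<parallel>E\<parallel>\<^sup>2\<close> (\<open>spectral_norm_gram\<close>).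

  For the inequality, \<open>E\<close> kills the columns of \<open>S\<close>, so \<open>E x = E (x - S y)\<close> for every \<open>y\<close>,
  whence \<open>\<parallel>E x\<parallel> \<le> \<parallel>B w\<parallel>\<close> for every \<open>w = x - S y\<close>.  The choice
  \<open>y = \<Omega>\<^sub>1\<^sup>\<dagger> U\<^sub>1\<^sup>T x\<close> removes the dominant part of \<open>w\<close>: full row rank makes
  \<open>\<Omega>\<^sub>1 \<Omega>\<^sub>1\<^sup>\<dagger>\<close> the identity, so \<open>U\<^sub>1\<^sup>T w = 0\<close>, while
  \<open>U\<^sub>2\<^sup>T w = U\<^sub>2\<^sup>T x - F U\<^sub>1\<^sup>T x\<close> with \<open>F = \<Omega>\<^sub>2 \<Omega>\<^sub>1\<^sup>\<dagger>\<close>.  Only the tail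
  block of \<open>A\<close> is left in \<open>\<parallel>B w\<parallel>\<^sup>2 = w \<bullet> A w \<le> \<parallel>\<Sigma>\<^sub>2\<parallel> \<parallel>U\<^sub>2\<^sup>T w\<parallel>\<^sup>2\<close>, and the
  Cauchy--Schwarz inequality in the plane, together with
  \<open>\<parallel>x\<parallel>\<^sup>2 = \<parallel>U\<^sub>1\<^sup>T x\<parallel>\<^sup>2 + \<parallel>U\<^sub>2\<^sup>T x\<parallel>\<^sup>2\<close>, gives the factor \<open>1 + \<parallel>F\<parallel>\<^sup>2\<close>
  (\<open>projection_projection_residual_norm_le\<close>).

  Pseudoinverse and square root are given by definite descriptions, so their existence and
  uniqueness carry part of the argument.  The pseudoinverse is built from solutions of the normal
  equations for a matrix and its transpose (\<open>is_pinv_exists\<close>); the square root comes from the given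
  diagonalization, whose eigenvectors determine every positive-semidefinite root
  (\<open>psd_root_eigenvector\<close>).
\<close>

section \<open>Euclidean and spectral norm\<close>

lemma minus_vec_eq_0_imp_eq:
  fixes v :: "real vec"
  assumes "v \<in> carrier_vec n" "w \<in> carrier_vec n" "v - w = 0\<^sub>v n"
  shows "v = w"
proof (rule eq_vecI)
  fix i assume "i < dim_vec w"
  then show "v $ i = w $ i"
    using arg_cong[OF assms(3), of "\<lambda>u. u $ i"] assms(1,2) by simp
qed (use assms in simp)

lemma vec_norm2_nonneg [simp]: "0 \<le> vec_norm2 v"
  by (simp add: vec_norm2_def scalar_prod_def sum_nonneg)

lemma vec_norm2_square: "(vec_norm2 v)\<^sup>2 = v \<bullet> v"
  by (simp add: vec_norm2_def scalar_prod_def sum_nonneg)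

lemma scalar_prod_self_nonneg:
  fixes v :: "real vec"
  shows "0 \<le> v \<bullet> v"
  by (simp add: scalar_prod_def sum_nonneg)

lemma vec_norm2_smult: "vec_norm2 (c \<cdot>\<^sub>v v) = \<bar>c\<bar> * vec_norm2 v"
proof -
  have "(c \<cdot>\<^sub>v v) \<bullet> (c \<cdot>\<^sub>v v) = c\<^sup>2 * (v \<bullet> v)"
    by (simp add: power2_eq_square)
  then show ?thesis
    by (simp add: vec_norm2_def real_sqrt_mult)
qed

lemma scalar_prod_self_eq_0_iff:
  fixes v :: "real vec"
  assumes "v \<in> carrier_vec n"
  shows "v \<bullet> v = 0 \<longleftrightarrow> v = 0\<^sub>v n"
proof -
  have "v \<bullet> v = (\<Sum>i = 0..<n. (v $ i)\<^sup>2)"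
    using assms by (simp add: scalar_prod_def power2_eq_square)
  then show ?thesis
    using assms by (auto simp: sum_nonneg_eq_0_iff)
qed

text \<open>The Cauchy--Schwarz inequality: expand the square of \<open>(w \<bullet> w) v - (v \<bullet> w) w\<close>, which is
  nonnegative.\<close>
lemma scalar_prod_le_vec_norm2:
  assumes v: "v \<in> carrier_vec n" and w: "w \<in> carrier_vec n"
  shows "v \<bullet> w \<le> vec_norm2 v * vec_norm2 w"
proof -
  have "(v \<bullet> w)\<^sup>2 \<le> (v \<bullet> v) * (w \<bullet> w)"
  proof (cases "w = 0\<^sub>v n")
    case True
    then show ?thesis
      using v by simp
  next
    case False
    then have pos: "0 < w \<bullet> w"
      using scalar_prod_self_eq_0_iff[OF w] scalar_prod_self_nonneg[of w] by simp
    define u where "u = (w \<bullet> w) \<cdot>\<^sub>v v - (v \<bullet> w) \<cdot>\<^sub>v w"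
    have "u \<bullet> u = (w \<bullet> w) * ((v \<bullet> v) * (w \<bullet> w) - (v \<bullet> w)\<^sup>2)"
      using v w by (simp add: u_def minus_scalar_prod_distrib[of _ n]
          scalar_prod_minus_distrib[of _ n] comm_scalar_prod[of w n v] power2_eq_square algebra_simps)
    then have "0 \<le> (w \<bullet> w) * ((v \<bullet> v) * (w \<bullet> w) - (v \<bullet> w)\<^sup>2)"
      using scalar_prod_self_nonneg[of u] by simp
    then show ?thesis
      using pos by (simp add: zero_le_mult_iff)
  qed
  then show ?thesis
    by (metis real_le_rsqrt real_sqrt_mult vec_norm2_def)
qed

lemma vec_norm2_minus_le:
  assumes "v \<in> carrier_vec n" "w \<in> carrier_vec n"
  shows "vec_norm2 (v - w) \<le> vec_norm2 v + vec_norm2 w"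
proof (rule power2_le_imp_le)
  have "(-1 \<cdot>\<^sub>v v) \<bullet> w \<le> vec_norm2 (-1 \<cdot>\<^sub>v v) * vec_norm2 w"
    using assms by (intro scalar_prod_le_vec_norm2) auto
  then have "- (v \<bullet> w) \<le> vec_norm2 v * vec_norm2 w"
    using assms by (simp add: vec_norm2_smult)
  moreover have "(v - w) \<bullet> (v - w) = v \<bullet> v + w \<bullet> w - 2 * (v \<bullet> w)"
    using assms by (simp add: minus_scalar_prod_distrib[of _ n] scalar_prod_minus_distrib[of _ n]
        comm_scalar_prod[of w n v])
  ultimately show "(vec_norm2 (v - w))\<^sup>2 \<le> (vec_norm2 v + vec_norm2 w)\<^sup>2"
    by (simp add: power2_sum vec_norm2_square)
qed simp

lemma scalar_prod_mult_mat_vec: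
  fixes M :: "real mat"
  assumes "M \<in> carrier_mat m n" "x \<in> carrier_vec m" "y \<in> carrier_vec n"
  shows "x \<bullet> (M *\<^sub>v y) = (M\<^sup>T *\<^sub>v x) \<bullet> y"
  using transpose_vec_mult_scalar[OF assms(1,3,2)] by simp

lemma vec_norm2_mult_square:
  assumes "M \<in> carrier_mat m n" "x \<in> carrier_vec n"
  shows "(vec_norm2 (M *\<^sub>v x))\<^sup>2 = x \<bullet> (M\<^sup>T * M *\<^sub>v x)"
proof -
  have "x \<bullet> (M\<^sup>T * M *\<^sub>v x) = x \<bullet> (M\<^sup>T *\<^sub>v (M *\<^sub>v x))"
    using assms by (simp add: assoc_mult_mat_vec[of _ n m _ n])
  also have "\<dots> = (M *\<^sub>v x) \<bullet> (M *\<^sub>v x)"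
    using assms scalar_prod_mult_mat_vec[of "M\<^sup>T" n m x "M *\<^sub>v x"] by simp
  finally show ?thesis
    by (simp add: vec_norm2_square)
qed

text \<open>The spectral norm is a supremum of reals, which bounds the values below it only if they are bounded
  above.  By Cauchy--Schwarz in each row, the Frobenius norm is such a bound.\<close>
lemma spectral_norm_bdd:
  assumes "M \<in> carrier_mat m n"
  shows "bdd_above ((\<lambda>x. vec_norm2 (M *\<^sub>v x)) ` {x \<in> carrier_vec n. vec_norm2 x \<le> 1})"
proof (rule bdd_aboveI2)
  fix x :: "real vec"
  assume x: "x \<in> {x \<in> carrier_vec n. vec_norm2 x \<le> 1}"
  let ?c = "\<lambda>i. vec_norm2 (row M i)"
  have "(row M i \<bullet> x)\<^sup>2 \<le> (?c i)\<^sup>2" if "i < m" for i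
  proof -
    have row: "row M i \<in> carrier_vec n"
      using assms that by auto
    have "\<bar>row M i \<bullet> x\<bar> \<le> ?c i * vec_norm2 x"
      using scalar_prod_le_vec_norm2[OF row, of x]
        scalar_prod_le_vec_norm2[of "-1 \<cdot>\<^sub>v row M i" n x] row x
      by (simp add: vec_norm2_smult abs_le_iff)
    also have "\<dots> \<le> ?c i * 1"
      using x by (intro mult_left_mono) auto
    finally show ?thesis
      by (simp flip: abs_le_square_iff)
  qed
  then have "(M *\<^sub>v x) \<bullet> (M *\<^sub>v x) \<le> (\<Sum>i = 0..<m. (?c i)\<^sup>2)"
    using assms unfolding scalar_prod_def[of "M *\<^sub>v x"]
    by (auto simp: power2_eq_square intro!: sum_mono)
  then show "vec_norm2 (M *\<^sub>v x) \<le> sqrt (\<Sum>i = 0..<m. (?c i)\<^sup>2)"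
    by (simp add: vec_norm2_def)
qed

lemma spectral_norm_nonneg:
  assumes "M \<in> carrier_mat m n"
  shows "0 \<le> spectral_norm M"
proof -
  have "vec_norm2 (M *\<^sub>v 0\<^sub>v n) \<le> spectral_norm M"
    using spectral_norm_bdd[OF assms] assms unfolding spectral_norm_def
    by (intro cSUP_upper) (auto simp: vec_norm2_def)
  then show ?thesis
    using vec_norm2_nonneg order_trans by blast
qed

lemma vec_norm2_mult_le:
  assumes M: "M \<in> carrier_mat m n" and x: "x \<in> carrier_vec n"
  shows "vec_norm2 (M *\<^sub>v x) \<le> spectral_norm M * vec_norm2 x"
proof (cases "x = 0\<^sub>v n")
  case True
  moreover have "M *\<^sub>v 0\<^sub>v n = 0\<^sub>v m"
    using M by auto
  ultimately show ?thesis
    by (simp add: vec_norm2_def)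
next
  case False
  then have pos: "vec_norm2 x > 0"
    using scalar_prod_self_eq_0_iff[OF x] vec_norm2_square[of x]
    by (metis less_eq_real_def power_zero_numeral vec_norm2_nonneg)
  let ?y = "(1 / vec_norm2 x) \<cdot>\<^sub>v x"
  have "vec_norm2 (M *\<^sub>v ?y) \<le> spectral_norm M"
    using spectral_norm_bdd[OF M] M x pos unfolding spectral_norm_def
    by (intro cSUP_upper) (auto simp: vec_norm2_smult)
  moreover have "M *\<^sub>v ?y = (1 / vec_norm2 x) \<cdot>\<^sub>v (M *\<^sub>v x)"
    using M x by (rule mult_mat_vec)
  ultimately show ?thesis
    using pos by (simp add: vec_norm2_smult divide_simps)
qed

lemma spectral_norm_le:
  assumes M: "M \<in> carrier_mat m n" and "0 \<le> c"
    and bound: "\<And>x. x \<in> carrier_vec n \<Longrightarrow> vec_norm2 (M *\<^sub>v x) \<le> c * vec_norm2 x"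
  shows "spectral_norm M \<le> c"
  unfolding spectral_norm_def
proof (rule cSUP_least)
  have "0\<^sub>v n \<in> {x \<in> carrier_vec (dim_col M). vec_norm2 x \<le> 1}"
    using M by (simp add: vec_norm2_def)
  then show "{x \<in> carrier_vec (dim_col M). vec_norm2 x \<le> 1} \<noteq> {}"
    by blast
next
  fix x :: "real vec"
  assume "x \<in> {x \<in> carrier_vec (dim_col M). vec_norm2 x \<le> 1}"
  then have "x \<in> carrier_vec n" "vec_norm2 x \<le> 1"
    using M by auto
  then show "vec_norm2 (M *\<^sub>v x) \<le> c"
    using bound[of x] mult_left_mono[of "vec_norm2 x" 1 c] \<open>0 \<le> c\<close> by linarith
qed

text \<open>Both inequalities come from moving \<open>M\<close> across the inner product.  In one direction,
  \<open>\<parallel>M x\<parallel>\<^sup>2 = x \<bullet> M\<^sup>T M x\<close>; in the other, the adjoint \<open>M\<^sup>T\<close> is bounded by the norm of \<open>M\<close>.\<close>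
lemma spectral_norm_gram:
  assumes M: "M \<in> carrier_mat m n"
  shows "spectral_norm (M\<^sup>T * M) = (spectral_norm M)\<^sup>2"
proof (rule antisym)
  have G: "M\<^sup>T * M \<in> carrier_mat n n"
    using M by simp
  have adjoint: "vec_norm2 (M\<^sup>T *\<^sub>v y) \<le> spectral_norm M * vec_norm2 y"
    if y: "y \<in> carrier_vec m" for y
  proof -
    let ?z = "M\<^sup>T *\<^sub>v y"
    have z: "?z \<in> carrier_vec n"
      using M y by simp
    have "(vec_norm2 ?z)\<^sup>2 = y \<bullet> (M *\<^sub>v ?z)"
      using scalar_prod_mult_mat_vec[OF M y z] by (simp add: vec_norm2_square)
    also have "\<dots> \<le> vec_norm2 y * vec_norm2 (M *\<^sub>v ?z)"
      using M y z by (intro scalar_prod_le_vec_norm2) auto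
    also have "\<dots> \<le> vec_norm2 y * (spectral_norm M * vec_norm2 ?z)"
      using vec_norm2_mult_le[OF M z] by (intro mult_left_mono) auto
    finally have "vec_norm2 ?z * vec_norm2 ?z \<le> vec_norm2 ?z * (spectral_norm M * vec_norm2 y)"
      by (simp add: power2_eq_square mult_ac)
    moreover have "0 \<le> spectral_norm M * vec_norm2 y"
      using spectral_norm_nonneg[OF M] by simp
    ultimately show ?thesis
      using vec_norm2_nonneg[of ?z] by (cases "vec_norm2 ?z = 0") (auto simp: mult_le_cancel_left)
  qed
  show "spectral_norm (M\<^sup>T * M) \<le> (spectral_norm M)\<^sup>2"
  proof (rule spectral_norm_le[OF G])
    fix x :: "real vec"
    assume x: "x \<in> carrier_vec n"
    have "vec_norm2 (M\<^sup>T * M *\<^sub>v x) = vec_norm2 (M\<^sup>T *\<^sub>v (M *\<^sub>v x))"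
      using M x by (simp add: assoc_mult_mat_vec[of _ n m _ n])
    also have "\<dots> \<le> spectral_norm M * vec_norm2 (M *\<^sub>v x)"
      using M x by (intro adjoint) simp
    also have "\<dots> \<le> spectral_norm M * (spectral_norm M * vec_norm2 x)"
      using vec_norm2_mult_le[OF M x] spectral_norm_nonneg[OF M] by (rule mult_left_mono)
    finally show "vec_norm2 (M\<^sup>T * M *\<^sub>v x) \<le> (spectral_norm M)\<^sup>2 * vec_norm2 x"
      by (simp add: power2_eq_square mult_ac)
  qed simp
  have "spectral_norm M \<le> sqrt (spectral_norm (M\<^sup>T * M))"
  proof (rule spectral_norm_le[OF M])
    fix x :: "real vec"
    assume x: "x \<in> carrier_vec n"
    have "(vec_norm2 (M *\<^sub>v x))\<^sup>2 \<le> vec_norm2 x * vec_norm2 (M\<^sup>T * M *\<^sub>v x)"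
      unfolding vec_norm2_mult_square[OF M x] using G x by (intro scalar_prod_le_vec_norm2) auto
    also have "\<dots> \<le> vec_norm2 x * (spectral_norm (M\<^sup>T * M) * vec_norm2 x)"
      using vec_norm2_mult_le[OF G x] by (intro mult_left_mono) auto
    also have "\<dots> = (sqrt (spectral_norm (M\<^sup>T * M)) * vec_norm2 x)\<^sup>2"
      using spectral_norm_nonneg[OF G] by (simp add: power_mult_distrib) (simp add: power2_eq_square)
    finally show "vec_norm2 (M *\<^sub>v x) \<le> sqrt (spectral_norm (M\<^sup>T * M)) * vec_norm2 x"
      by (rule power2_le_imp_le) (simp add: spectral_norm_nonneg[OF G])
  qed (simp add: spectral_norm_nonneg[OF G])
  then have "(spectral_norm M)\<^sup>2 \<le> (sqrt (spectral_norm (M\<^sup>T * M)))\<^sup>2"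
    using spectral_norm_nonneg[OF M] by (rule power_mono)
  then show "(spectral_norm M)\<^sup>2 \<le> spectral_norm (M\<^sup>T * M)"
    using spectral_norm_nonneg[OF G] by simp
qed

section \<open>Existence and uniqueness of the pseudoinverse\<close>

text \<open>Gram--Schmidt, one column at a time.  The induction produces, for each \<open>j\<close>, a combination of the
  first \<open>j\<close> columns whose residual is orthogonal to those columns.  Keeping the support of the
  coefficient vector in the induction hypothesis is what makes the combination itself orthogonal to
  every vector that is orthogonal to the first \<open>j\<close> columns.\<close>
lemma least_squares_exists:
  fixes M :: "real mat"
  assumes M: "M \<in> carrier_mat m n" and b: "b \<in> carrier_vec m"
  shows "\<exists>g \<in> carrier_vec n. M\<^sup>T *\<^sub>v (b - M *\<^sub>v g) = 0\<^sub>v n"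
proof -
  have "\<exists>g \<in> carrier_vec n. (\<forall>i<n. j \<le> i \<longrightarrow> g $ i = 0)
          \<and> (\<forall>i<j. (M\<^sup>T *\<^sub>v (b - M *\<^sub>v g)) $ i = 0)"
    if "j \<le> n" "b \<in> carrier_vec m" for j b
    using that
  proof (induction j arbitrary: b)
    case 0
    show ?case
      by (intro bexI[of _ "0\<^sub>v n"]) auto
  next
    case (Suc j)
    note b = \<open>b \<in> carrier_vec m\<close>
    have j: "j < n"
      using Suc.prems by simp
    let ?e = "unit_vec n j :: real vec"
    let ?c = "M *\<^sub>v ?e"
    have c: "?c \<in> carrier_vec m"
      using M by simp
    obtain g where g: "g \<in> carrier_vec n" and g0: "\<And>i. i < n \<Longrightarrow> j \<le> i \<Longrightarrow> g $ i = 0"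
      and g_orth: "\<And>i. i < j \<Longrightarrow> (M\<^sup>T *\<^sub>v (b - M *\<^sub>v g)) $ i = 0"
      using Suc.IH[OF _ b] j by auto
    obtain h where h: "h \<in> carrier_vec n" and h0: "\<And>i. i < n \<Longrightarrow> j \<le> i \<Longrightarrow> h $ i = 0"
      and h_orth: "\<And>i. i < j \<Longrightarrow> (M\<^sup>T *\<^sub>v (?c - M *\<^sub>v h)) $ i = 0"
      using Suc.IH[OF _ c] j by auto
    \<comment> \<open>\<open>s\<close> and \<open>r\<close> are the parts of \<open>b\<close> and of column \<open>j\<close> that are orthogonal to the earlier
      columns; the step removes from \<open>s\<close> its component along \<open>r\<close>.\<close>
    define s where "s = b - M *\<^sub>v g"
    define r where "r = ?c - M *\<^sub>v h"
    have s: "s \<in> carrier_vec m" and r: "r \<in> carrier_vec m"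
      using M b g h by (auto simp: s_def r_def)
    have h_perp: "(M *\<^sub>v h) \<bullet> y = 0"
      if y: "y \<in> carrier_vec m" and y0: "\<And>i. i < j \<Longrightarrow> (M\<^sup>T *\<^sub>v y) $ i = 0" for y
    proof -
      have "(M *\<^sub>v h) \<bullet> y = h \<bullet> (M\<^sup>T *\<^sub>v y)"
        using scalar_prod_mult_mat_vec[of "M\<^sup>T" n m h y] M h y by simp
      also have "\<dots> = (\<Sum>i = 0..<n. h $ i * (M\<^sup>T *\<^sub>v y) $ i)"
        using M by (simp add: scalar_prod_def)
      also have "\<dots> = 0"
      proof (rule sum.neutral, rule ballI)
        fix i assume "i \<in> {0..<n}"
        then show "h $ i * (M\<^sup>T *\<^sub>v y) $ i = 0"
          using h0[of i] y0[of i] by (cases "i < j") auto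
      qed
      finally show ?thesis .
    qed
    have hs: "(M *\<^sub>v h) \<bullet> s = 0" and hr: "(M *\<^sub>v h) \<bullet> r = 0"
      using h_perp[OF s] h_perp[OF r] g_orth h_orth by (auto simp: s_def r_def)
    have rr: "r \<bullet> r = ?c \<bullet> r" and rs: "r \<bullet> s = ?c \<bullet> s"
      using minus_scalar_prod_distrib[OF c _ r, of "M *\<^sub>v h"]
        minus_scalar_prod_distrib[OF c _ s, of "M *\<^sub>v h"] hs hr M h by (auto simp: r_def)
    \<comment> \<open>If \<open>r = 0\<close>, then \<open>t = 0\<close> by division by zero; column \<open>j\<close> then imposes no new condition.\<close>
    define t where "t = (?c \<bullet> s) / (r \<bullet> r)"
    have t: "?c \<bullet> s = t * (?c \<bullet> r)"
    proof (cases "r \<bullet> r = 0")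
      case True
      then have "r = 0\<^sub>v m"
        using scalar_prod_self_eq_0_iff[OF r] by simp
      then have "?c \<bullet> s = 0"
        using rs s by simp
      then show ?thesis
        by (simp add: t_def)
    next
      case False
      then show ?thesis
        by (simp add: t_def rr)
    qed
    define g' where "g' = g + t \<cdot>\<^sub>v (?e - h)"
    have g': "g' \<in> carrier_vec n"
      using g h by (simp add: g'_def)
    have "M *\<^sub>v g' = M *\<^sub>v g + t \<cdot>\<^sub>v r"
      using M g h by (simp add: g'_def r_def mult_add_distrib_mat_vec[of _ m n]
          mult_minus_distrib_mat_vec[of _ m n] mult_mat_vec[of _ m n])
    then have s': "b - M *\<^sub>v g' = s - t \<cdot>\<^sub>v r"
      using M b g r by (auto simp: s_def intro!: eq_vecI)
    have Ms': "M\<^sup>T *\<^sub>v (b - M *\<^sub>v g') = M\<^sup>T *\<^sub>v s - t \<cdot>\<^sub>v (M\<^sup>T *\<^sub>v r)"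
      unfolding s' using M s r
      by (simp add: mult_minus_distrib_mat_vec[of _ n m] mult_mat_vec[of _ n m])
    have entry: "(M\<^sup>T *\<^sub>v y) $ j = ?c \<bullet> y" if "y \<in> carrier_vec m" for y
    proof -
      have "?c \<bullet> y = ?e \<bullet> (M\<^sup>T *\<^sub>v y)"
        using scalar_prod_mult_mat_vec[of "M\<^sup>T" n m ?e y] M that by simp
      then show ?thesis
        using j M that by (simp add: scalar_prod_left_unit)
    qed
    show ?case
    proof (intro bexI[OF _ g'] conjI allI impI)
      fix i assume "i < n" "Suc j \<le> i"
      then show "g' $ i = 0"
        using g h g0[of i] h0[of i] by (simp add: g'_def)
    next
      fix i assume "i < Suc j"
      then consider "i < j" | "i = j"
        by linarith
      then show "(M\<^sup>T *\<^sub>v (b - M *\<^sub>v g')) $ i = 0"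
      proof cases
        case 1
        then show ?thesis
          using g_orth[of i] h_orth[of i] j M unfolding Ms' by (simp add: s_def r_def)
      next
        case 2
        then show ?thesis
          using entry[OF s] entry[OF r] t j M unfolding Ms' by simp
      qed
    qed
  qed
  from this[OF order_refl b] show ?thesis
    using M by (auto intro!: bexI eq_vecI)
qed

lemma mult_mat_unit_vec:
  fixes M :: "real mat"
  assumes "M \<in> carrier_mat m n" "j < n"
  shows "M *\<^sub>v unit_vec n j = col M j"
  using assms by (intro eq_vecI) (auto simp: scalar_prod_right_unit)

lemma normal_equations_solvable:
  fixes M :: "real mat"
  assumes M: "M \<in> carrier_mat m n"
  obtains G where "G \<in> carrier_mat n m" "M\<^sup>T * M * G = M\<^sup>T"
proof -
  have "\<exists>g \<in> carrier_vec n. M\<^sup>T * M *\<^sub>v g = M\<^sup>T *\<^sub>v unit_vec m j" for j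
  proof -
    obtain g where g: "g \<in> carrier_vec n"
      and 0: "M\<^sup>T *\<^sub>v (unit_vec m j - M *\<^sub>v g) = 0\<^sub>v n"
      using least_squares_exists[OF M, of "unit_vec m j"] by auto
    have "M\<^sup>T *\<^sub>v (unit_vec m j - M *\<^sub>v g) = M\<^sup>T *\<^sub>v unit_vec m j - M\<^sup>T * M *\<^sub>v g"
      using M g by (simp add: mult_minus_distrib_mat_vec[of _ n m])
    then have eq: "M\<^sup>T *\<^sub>v unit_vec m j - M\<^sup>T * M *\<^sub>v g = 0\<^sub>v n"
      using 0 by simp
    have "M\<^sup>T *\<^sub>v unit_vec m j = M\<^sup>T * M *\<^sub>v g"
      using M g by (intro minus_vec_eq_0_imp_eq[OF _ _ eq]) auto
    then have "M\<^sup>T * M *\<^sub>v g = M\<^sup>T *\<^sub>v unit_vec m j"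
      by (rule sym)
    then show ?thesis
      using g by blast
  qed
  then obtain g where g: "\<And>j. g j \<in> carrier_vec n"
    and eq: "\<And>j. M\<^sup>T * M *\<^sub>v g j = M\<^sup>T *\<^sub>v unit_vec m j"
    by metis
  define G where "G = mat_of_cols n (map g [0..<m])"
  have G: "G \<in> carrier_mat n m"
    using mat_of_cols_carrier(1)[of n "map g [0..<m]"] by (simp add: G_def)
  have "col (M\<^sup>T * M * G) j = col M\<^sup>T j" if "j < m" for j
  proof -
    have "col G j = g j"
      using g that by (simp add: G_def)
    then have "col (M\<^sup>T * M * G) j = M\<^sup>T * M *\<^sub>v g j"
      using M G that col_mult2[of "M\<^sup>T * M" n n G m j]
      by (simp del: assoc_mult_mat assoc_mult_mat_vec)
    also have "\<dots> = col M\<^sup>T j"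
      unfolding eq using M that by (simp add: mult_mat_unit_vec[of _ n m])
    finally show ?thesis .
  qed
  then have "M\<^sup>T * M * G = M\<^sup>T"
    using M G by (intro mat_col_eqI) auto
  with G show ?thesis
    by (rule that)
qed

definition is_pinv :: "real mat \<Rightarrow> real mat \<Rightarrow> bool" where
  "is_pinv M X \<longleftrightarrow> X \<in> carrier_mat (dim_col M) (dim_row M) \<and>
     M * X * M = M \<and> X * M * X = X \<and> (M * X)\<^sup>T = M * X \<and> (X * M)\<^sup>T = X * M"

text \<open>\<open>M X\<close> and \<open>M Y\<close> are orthogonal projections onto the same column space, hence equal, and likewise
  \<open>X M\<close> and \<open>Y M\<close>; algebraically, the transpose of \<open>M X = (M Y) (M X)\<close> is \<open>(M X) (M Y) = M Y\<close>.
  Then \<open>X = X M X = X M Y = Y M Y = Y\<close>.\<close>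

lemma is_pinv_unique:
  assumes "is_pinv M X" "is_pinv M Y"
  shows "X = Y"
proof -
  obtain m n where M: "M \<in> carrier_mat m n"
    by auto
  then have X: "X \<in> carrier_mat n m" and Y: "Y \<in> carrier_mat n m"
    using assms by (auto simp: is_pinv_def)
  have pX: "M * X * M = M" "X * M * X = X" "(M * X)\<^sup>T = M * X" "(X * M)\<^sup>T = X * M"
    and pY: "M * Y * M = M" "Y * M * Y = Y" "(M * Y)\<^sup>T = M * Y" "(Y * M)\<^sup>T = Y * M"
    using assms by (auto simp: is_pinv_def)
  have "M * X = ((M * Y * M) * X)\<^sup>T"
    using pX pY by simp
  also have "\<dots> = ((M * Y) * (M * X))\<^sup>T"
    using M X Y assoc_mult_mat[of "M * Y" m m M n X m] by (simp del: assoc_mult_mat)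
  also have "\<dots> = (M * X)\<^sup>T * (M * Y)\<^sup>T"
    using M X Y by (intro transpose_mult[of _ m m _ m]) auto
  also have "\<dots> = (M * X * M) * Y"
    unfolding pX(3) pY(3) using M X Y assoc_mult_mat[of "M * X" m m M n Y m]
    by (simp del: assoc_mult_mat)
  finally have l: "M * X = M * Y"
    by (simp add: pX)
  have "X * M = (X * (M * Y * M))\<^sup>T"
    using pX pY by simp
  also have "\<dots> = ((X * M) * (Y * M))\<^sup>T"
    using M X Y assoc_mult_mat[of X n m M n "Y * M" n] assoc_mult_mat[of M m n Y m M n] by simp
  also have "\<dots> = (Y * M)\<^sup>T * (X * M)\<^sup>T"
    using M X Y by (intro transpose_mult[of _ n n _ n]) auto
  also have "\<dots> = Y * (M * X * M)"
    unfolding pX(4) pY(4)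
    using M X Y assoc_mult_mat[of Y n m M n "X * M" n] assoc_mult_mat[of M m n X m M n] by simp
  finally have r: "X * M = Y * M"
    by (simp add: pX)
  have "X = X * M * Y"
    using M X Y pX(2) l assoc_mult_mat[of X n m M n X m] assoc_mult_mat[of X n m M n Y m] by simp
  also have "\<dots> = Y"
    using pY r by simp
  finally show ?thesis .
qed

text \<open>If \<open>M\<^sup>T M G = M\<^sup>T\<close>, then \<open>M G\<close> is the orthogonal projection onto the column space of \<open>M\<close>; the same
  construction for \<open>M\<^sup>T\<close> yields the projection \<open>Q\<close> onto the row space.  The generalized inverse \<open>G\<close> may
  have components in the kernel of \<open>M\<close>; the product \<open>Q G\<close> removes them.\<close>
lemma is_pinv_exists:
  obtains X where "is_pinv M X"
proof -
  obtain m n where M: "M \<in> carrier_mat m n"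
    by auto
  obtain G where G: "G \<in> carrier_mat n m" and MMG: "M\<^sup>T * M * G = M\<^sup>T"
    by (rule normal_equations_solvable[OF M])
  obtain K where K: "K \<in> carrier_mat m n" and MMK: "M * M\<^sup>T * K = M"
    using normal_equations_solvable[of "M\<^sup>T" n m] M by auto
  define P where "P = M * G"
  define Q where "Q = M\<^sup>T * K"
  have P: "P \<in> carrier_mat m m" and Q: "Q \<in> carrier_mat n n"
    using M G K by (auto simp: P_def Q_def)
  have MTP: "M\<^sup>T * P = M\<^sup>T"
    using MMG M G by (simp add: P_def assoc_mult_mat[of _ n m _ n _ m])
  have MQ: "M * Q = M"
    using MMK M K by (simp add: Q_def assoc_mult_mat[of _ m n _ m _ n])
  have PT: "P\<^sup>T = G\<^sup>T * M\<^sup>T"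
    unfolding P_def using M G by (rule transpose_mult)
  have "P\<^sup>T * P = P\<^sup>T"
    unfolding PT using M G P MTP by (simp add: assoc_mult_mat[of "G\<^sup>T" m n "M\<^sup>T" m P m])
  moreover have "(P\<^sup>T * P)\<^sup>T = P\<^sup>T * P"
    using P by (simp add: transpose_mult[of _ m m _ m])
  ultimately have PS: "P\<^sup>T = P"
    by (metis transpose_transpose)
  have QT: "Q\<^sup>T = K\<^sup>T * M"
    unfolding Q_def using M K by (simp add: transpose_mult[of "M\<^sup>T" n m K n])
  have "Q\<^sup>T * Q = Q\<^sup>T"
    unfolding QT using M K Q MQ by (simp add: assoc_mult_mat[of "K\<^sup>T" n m M n Q n])
  moreover have "(Q\<^sup>T * Q)\<^sup>T = Q\<^sup>T * Q"
    using Q by (simp add: transpose_mult[of _ n n _ n])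
  ultimately have QS: "Q\<^sup>T = Q"
    by (metis transpose_transpose)
  have QQ: "Q * Q = Q"
    using \<open>Q\<^sup>T * Q = Q\<^sup>T\<close> QS by simp
  have PM: "P * M = M"
  proof -
    have "P * M = (M\<^sup>T * P\<^sup>T)\<^sup>T"
      using M P by (simp add: transpose_mult[of _ n m _ m])
    then show ?thesis
      by (simp add: PS MTP)
  qed
  define X where "X = Q * G"
  have X: "X \<in> carrier_mat n m"
    using Q G by (simp add: X_def)
  have MX: "M * X = P"
    using M Q G MQ by (simp add: X_def P_def assoc_mult_mat[of M m n Q n G m, symmetric])
  have XM: "X * M = Q"
  proof -
    have "X * M = K\<^sup>T * M * G * M"
      using QS QT by (simp add: X_def)
    also have "\<dots> = K\<^sup>T * (P * M)"
      using M K G by (simp add: P_def assoc_mult_mat[of "K\<^sup>T" n m M n G m]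
          assoc_mult_mat[of "K\<^sup>T" n m "M * G" m M n])
    finally show ?thesis
      using PM QS QT by simp
  qed
  have "Q * X = X"
    using Q G QQ by (simp add: X_def assoc_mult_mat[of Q n n Q n G m, symmetric])
  then have "is_pinv M X"
    using M X by (simp add: is_pinv_def MX XM PM PS QS)
  then show ?thesis
    by (rule that)
qed

lemma pinv_eqI:
  assumes "is_pinv M X"
  shows "pinv M = X"
proof -
  have "pinv M = (THE X. is_pinv M X)"
    by (simp add: pinv_def is_pinv_def)
  also have "\<dots> = X"
    using assms is_pinv_unique by (intro the_equality) auto
  finally show ?thesis .
qed

lemma is_pinv_pinv: "is_pinv M (pinv M)"
  using is_pinv_exists pinv_eqI by metis

lemma
  assumes "M \<in> carrier_mat m n"
  shows pinv_carrier: "pinv M \<in> carrier_mat n m"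
    and mult_pinv_mult: "M * pinv M * M = M"
    and pinv_mult_pinv: "pinv M * M * pinv M = pinv M"
    and transpose_mult_pinv: "(M * pinv M)\<^sup>T = M * pinv M"
    and transpose_pinv_mult: "(pinv M * M)\<^sup>T = pinv M * M"
  using is_pinv_pinv[of M] assms by (auto simp: is_pinv_def)

lemma pinv_transpose:
  "pinv (M\<^sup>T) = (pinv M)\<^sup>T"
proof (rule pinv_eqI)
  let ?X = "pinv M"
  obtain m n where M: "M \<in> carrier_mat m n"
    by auto
  note X = pinv_carrier[OF M]
  have 1: "M\<^sup>T * ?X\<^sup>T = (?X * M)\<^sup>T" and 2: "?X\<^sup>T * M\<^sup>T = (M * ?X)\<^sup>T"
    using M X by (auto simp: transpose_mult[of _ n m _ n] transpose_mult[of _ m n _ m])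
  have "M\<^sup>T * ?X\<^sup>T * M\<^sup>T = (M * (?X * M))\<^sup>T"
    unfolding 1 using M X by (simp add: transpose_mult[of M m n "?X * M" n])
  moreover have "?X\<^sup>T * M\<^sup>T * ?X\<^sup>T = (?X * (M * ?X))\<^sup>T"
    unfolding 2 using M X by (simp add: transpose_mult[of ?X n m "M * ?X" m])
  ultimately have "M\<^sup>T * ?X\<^sup>T * M\<^sup>T = M\<^sup>T" "?X\<^sup>T * M\<^sup>T * ?X\<^sup>T = ?X\<^sup>T"
    using mult_pinv_mult[OF M] pinv_mult_pinv[OF M] M X
    by (simp_all add: assoc_mult_mat[of M m n ?X m M n] assoc_mult_mat[of ?X n m M n ?X m])
  then show "is_pinv (M\<^sup>T) (?X\<^sup>T)"
    unfolding is_pinv_def using M X by (simp add: 1 2 transpose_mult_pinv[OF M] transpose_pinv_mult[OF M])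
qed

text \<open>The diagonal entries of a Gram matrix are the squared norms of the columns.\<close>
lemma gram_eq_0_imp_eq_0:
  fixes N :: "real mat"
  assumes N: "N \<in> carrier_mat m n" and gram: "N\<^sup>T * N = 0\<^sub>m n n"
  shows "N = 0\<^sub>m m n"
proof (rule eq_matI)
  fix i j assume ij: "i < dim_row (0\<^sub>m m n)" "j < dim_col (0\<^sub>m m n)"
  have "col N j \<bullet> col N j = (N\<^sup>T * N) $$ (j, j)"
    using N ij by simp
  then have "col N j = 0\<^sub>v m"
    using scalar_prod_self_eq_0_iff[of "col N j" m] gram N ij by simp
  then have "col N j $ i = 0"
    using ij by simp
  then show "N $$ (i, j) = 0\<^sub>m m n $$ (i, j)"
    using N ij by simp
qed (use N in auto)

text \<open>The matrix \<open>W = M\<^sup>T M\<close> is symmetric, and so is its pseudoinverse \<open>V\<close>.  Of the four Penrose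
  equations for \<open>V M\<^sup>T\<close> only \<open>M V W = M\<close> has content: \<open>N = M V W - M\<close> satisfies
  \<open>M\<^sup>T N = W V W - W = 0\<close>, hence \<open>N\<^sup>T N = 0\<close>, hence \<open>N = 0\<close>.\<close>
lemma pinv_gram:
  assumes M: "M \<in> carrier_mat m n"
  shows "pinv M = pinv (M\<^sup>T * M) * M\<^sup>T"
proof (rule pinv_eqI)
  define W where "W = M\<^sup>T * M"
  define V where "V = pinv W"
  have W: "W \<in> carrier_mat n n" and WS: "W\<^sup>T = W"
    using M by (auto simp: W_def transpose_mult[of _ n m _ n])
  note V = pinv_carrier[OF W, folded V_def] and WVW = mult_pinv_mult[OF W, folded V_def]
    and VWV = pinv_mult_pinv[OF W, folded V_def] and VW = transpose_pinv_mult[OF W, folded V_def]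
  have VS: "V\<^sup>T = V"
    using pinv_transpose[of W] WS by (simp add: V_def)
  have XM: "V * M\<^sup>T * M = V * W"
    using M V by (simp add: W_def assoc_mult_mat[of V n n "M\<^sup>T" m M n])
  have "M * (V * W) = M"
  proof -
    define N where "N = M * (V * W) - M"
    have N: "N \<in> carrier_mat m n"
      unfolding N_def using M by (rule minus_carrier_mat)
    have "M\<^sup>T * N = M\<^sup>T * (M * (V * W)) - W"
      unfolding N_def W_def[symmetric] using M V W
      by (simp add: mult_minus_distrib_mat[of "M\<^sup>T" n m _ n] W_def)
    also have "M\<^sup>T * (M * (V * W)) = W * (V * W)"
      unfolding W_def using M V by (intro assoc_mult_mat[of "M\<^sup>T" n m M n _ n, symmetric]) auto
    also have "W * (V * W) = W"
      using WVW V W by (simp add: assoc_mult_mat[of W n n V n W n])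
    finally have MN: "M\<^sup>T * N = 0\<^sub>m n n"
      using W by simp
    have "N\<^sup>T * N = ((V * W) \<^sup>T * M\<^sup>T - M\<^sup>T) * N"
      using M V W by (simp add: N_def transpose_minus[of _ m n] transpose_mult[of M m n _ n])
    also have "\<dots> = (V * W)\<^sup>T * (M\<^sup>T * N) - M\<^sup>T * N"
      using M V W N mult_carrier_mat[of "(V * W)\<^sup>T" n n "M\<^sup>T" m] minus_mult_distrib_mat[of "(V * W)\<^sup>T * M\<^sup>T" n m "M\<^sup>T" N n]
        assoc_mult_mat[of "(V * W)\<^sup>T" n n "M\<^sup>T" m N n]
      by (simp del: assoc_mult_mat)
    also have "\<dots> = 0\<^sub>m n n"
      unfolding MN using V W by simp
    finally have "N = 0\<^sub>m m n"
      by (rule gram_eq_0_imp_eq_0[OF N])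
    then have "(N + M) = M"
      using M by simp
    moreover have "N + M = M * (V * W)"
      using M V W by (auto simp: N_def intro!: eq_matI)
    ultimately show ?thesis
      by simp
  qed
  moreover have "M * (V * M\<^sup>T) * M = M * (V * W)"
    using M V W XM by (simp add: assoc_mult_mat[of M m n _ m _ n])
  moreover have "(M * (V * M\<^sup>T))\<^sup>T = M * (V * M\<^sup>T)"
    using M V VS by (simp add: transpose_mult[of M m n _ m] transpose_mult[of V n n _ m]
        assoc_mult_mat[of M m n V n _ m])
  moreover have "V * W * (V * M\<^sup>T) = V * M\<^sup>T"
    using VWV M V W by (simp add: assoc_mult_mat[of "V * W" n n V n _ m, symmetric])
  ultimately show "is_pinv M (pinv (M\<^sup>T * M) * M\<^sup>T)"
    unfolding is_pinv_def W_def[symmetric] V_def[symmetric]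
    using M V by (simp add: XM VW)
qed

text \<open>A maximal independent set of columns has \<open>k\<close> elements, so it is a basis of the whole space.\<close>
lemma full_row_rank_imp_surj:
  fixes M :: "real mat"
  assumes M: "M \<in> carrier_mat k l" and rank: "vec_space.rank k M = k" and y: "y \<in> carrier_vec k"
  obtains x where "x \<in> carrier_vec l" "M *\<^sub>v x = y"
proof -
  interpret vec_space "TYPE(real)" k .
  have cols: "set (cols M) \<subseteq> carrier_vec k"
    using M cols_dim by blast
  obtain T where T: "maximal T (\<lambda>T. T \<subseteq> set (cols M) \<and> lin_indpt T)"
    using maximal_exists_superset[of "set (cols M)" "\<lambda>T. T \<subseteq> set (cols M) \<and> lin_indpt T" "{}"]
    by (auto simp: lin_dep_def)
  then have sub: "T \<subseteq> set (cols M)" and indpt: "lin_indpt T"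
    by (auto simp: maximal_def)
  have "card T = k"
    using rank_card_indpt[OF M T] rank by simp
  then have "basis T"
    using sub cols indpt by (intro dim_li_is_basis) (auto simp: dim_is_n intro: finite_subset)
  then have "span T = carrier_vec k"
    by (simp add: basis_def)
  then have "y \<in> col_space M"
    using y span_is_monotone[OF sub] by (auto simp: col_space_def)
  then show ?thesis
    using M that by (auto simp: col_space_eq)
qed

text \<open>\<open>M M\<^sup>\<dagger>\<close> fixes every vector \<open>M x\<close>, and here these are all vectors.\<close>
lemma mult_pinv_full_row_rank:
  assumes M: "M \<in> carrier_mat k l" and rank: "vec_space.rank k M = k"
  shows "M * pinv M = 1\<^sub>m k"
proof (rule eq_matI)
  note X = pinv_carrier[OF M]
  fix i j assume ij: "i < dim_row (1\<^sub>m k :: real mat)" "j < dim_col (1\<^sub>m k :: real mat)"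
  obtain x where x: "x \<in> carrier_vec l" "M *\<^sub>v x = unit_vec k j"
    by (rule full_row_rank_imp_surj[OF M rank, of "unit_vec k j"]) auto
  have "col (M * pinv M) j = M * pinv M *\<^sub>v (M *\<^sub>v x)"
    unfolding x using M X ij by (simp add: mult_mat_unit_vec[of _ k k])
  also have "\<dots> = M * pinv M * M *\<^sub>v x"
    using M X x assoc_mult_mat_vec[of "M * pinv M" k k M l x]
    by (simp del: assoc_mult_mat assoc_mult_mat_vec)
  also have "\<dots> = unit_vec k j"
    using mult_pinv_mult[OF M] x by simp
  finally show "(M * pinv M) $$ (i, j) = 1\<^sub>m k $$ (i, j)"
    using M X ij by (metis (no_types, lifting) carrier_matD index_col index_mult_mat(2,3) index_one_mat
        index_unit_vec(1))
qed (use M pinv_carrier[OF M] in auto)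

section \<open>The positive-semidefinite square root\<close>

text \<open>For \<open>w = C u - s u\<close>, factoring
  \<open>C\<^sup>2 - s\<^sup>2\<close> gives \<open>C w = - s w\<close>; if \<open>s > 0\<close>, semidefiniteness of \<open>C\<close> leaves only \<open>w = 0\<close>.  If
  \<open>s = 0\<close>, then \<open>\<parallel>C u\<parallel>\<^sup>2 = u \<bullet> C\<^sup>2 u = 0\<close>.\<close>
lemma psd_root_eigenvector:
  assumes C: "psd n C" and u: "u \<in> carrier_vec n" and "0 \<le> s"
    and eig: "C * C *\<^sub>v u = s\<^sup>2 \<cdot>\<^sub>v u"
  shows "C *\<^sub>v u = s \<cdot>\<^sub>v u"
proof -
  have CC: "C \<in> carrier_mat n n" and CT: "C\<^sup>T = C"
    using C by (auto simp: psd_def)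
  define w where "w = C *\<^sub>v u - s \<cdot>\<^sub>v u"
  have w: "w \<in> carrier_vec n"
    using CC u by (simp add: w_def)
  have CCu: "C *\<^sub>v (C *\<^sub>v u) = s\<^sup>2 \<cdot>\<^sub>v u"
    using eig CC u by simp
  have "w \<bullet> w = 0"
  proof (cases "s = 0")
    case True
    have "(C *\<^sub>v u) \<bullet> (C *\<^sub>v u) = (C *\<^sub>v (C *\<^sub>v u)) \<bullet> u"
      using scalar_prod_mult_mat_vec[OF CC _ u, of "C *\<^sub>v u"] CC CT u by simp
    also have "\<dots> = 0"
      unfolding CCu using u True by simp
    also have "C *\<^sub>v u = w"
      using CC u True by (auto simp: w_def)
    finally show ?thesis .
  next
    case False
    have "C *\<^sub>v w = (- s) \<cdot>\<^sub>v w"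
      using CC u CCu
      by (auto simp: w_def mult_minus_distrib_mat_vec[of _ n n] mult_mat_vec[of _ n n]
          power2_eq_square algebra_simps)
    then have "w \<bullet> (C *\<^sub>v w) = - s * (w \<bullet> w)"
      using w by simp
    then have "s * (w \<bullet> w) \<le> 0"
      using C w unfolding psd_def by (metis neg_0_le_iff_le mult_minus_left)
    then have "w \<bullet> w \<le> 0"
      using False \<open>0 \<le> s\<close> by (simp add: mult_le_0_iff)
    then show ?thesis
      using scalar_prod_self_nonneg[of w] by simp
  qed
  then have "w = 0\<^sub>v n"
    using scalar_prod_self_eq_0_iff[OF w] by simp
  then show ?thesis
    using CC u minus_vec_eq_0_imp_eq[of "C *\<^sub>v u" n "s \<cdot>\<^sub>v u"] by (simp add: w_def)
qed

text \<open>A diagonalization \<open>A = U D U\<^sup>T\<close> with \<open>U\<close> orthogonal yields the root \<open>U D^{1/2} U\<^sup>T\<close>, and the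
  eigenvectors in the columns of \<open>U\<close> decide what any root has to be.\<close>

context
  fixes n :: nat and A U :: "real mat" and d :: "nat \<Rightarrow> real"
  assumes A: "psd n A" and U: "U \<in> carrier_mat n n" and UU: "U\<^sup>T * U = 1\<^sub>m n"
    and decomp: "A = U * mat_diag n d * U\<^sup>T"
begin

lemma orthogonal_transpose: "U * U\<^sup>T = 1\<^sub>m n"
  using mat_mult_left_right_inverse[OF _ U UU] U by simp

lemma eigenvector_col:
  assumes i: "i < n"
  shows "A *\<^sub>v col U i = d i \<cdot>\<^sub>v col U i"
proof -
  define D where "D = mat_diag n d"
  have D: "D \<in> carrier_mat n n"
    by (simp add: D_def)
  have "A *\<^sub>v col U i = A *\<^sub>v (U *\<^sub>v unit_vec n i)"
    using mult_mat_unit_vec[OF U i] by simp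
  also have "\<dots> = U * D *\<^sub>v (U\<^sup>T * U *\<^sub>v unit_vec n i)"
    unfolding decomp D_def[symmetric]
    using U D assoc_mult_mat_vec[of "U * D" n n "U\<^sup>T" n "U *\<^sub>v unit_vec n i"]
      assoc_mult_mat_vec[of "U\<^sup>T" n n U n "unit_vec n i"]
    by (simp del: assoc_mult_mat assoc_mult_mat_vec)
  also have "\<dots> = U *\<^sub>v (D *\<^sub>v unit_vec n i)"
    unfolding UU using U D by simp
  also have "D *\<^sub>v unit_vec n i = d i \<cdot>\<^sub>v unit_vec n i"
    unfolding mult_mat_unit_vec[OF D i] using i
    by (auto simp: D_def mat_diag_def)
  finally show ?thesis
    using U mult_mat_unit_vec[OF U i] mult_mat_vec[OF U, of "unit_vec n i"] by simp
qed

lemma eigenvalue_nonneg: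
  assumes i: "i < n"
  shows "0 \<le> d i"
proof -
  have u: "col U i \<in> carrier_vec n"
    using U i by auto
  have "col U i \<bullet> col U i = (U\<^sup>T * U) $$ (i, i)"
    using U i by simp
  then have "col U i \<bullet> col U i = 1"
    using UU i by simp
  then have "d i = col U i \<bullet> (A *\<^sub>v col U i)"
    using eigenvector_col[OF i] u by simp
  then show ?thesis
    using A u by (simp add: psd_def)
qed

text \<open>Two roots act in the same way on the columns of \<open>U\<close>, which form a basis.\<close>
lemma psd_sqrt_unique:
  assumes B: "psd n B" "B * B = A" and C: "psd n C" "C * C = A"
  shows "B = C"
proof -
  have carr: "B \<in> carrier_mat n n" "C \<in> carrier_mat n n"
    using B C by (auto simp: psd_def)
  have "R *\<^sub>v col U i = sqrt (d i) \<cdot>\<^sub>v col U i" if "i < n" "psd n R" "R * R = A" for R i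
  proof (rule psd_root_eigenvector[OF that(2)])
    show "col U i \<in> carrier_vec n"
      using U that(1) by auto
    show "0 \<le> sqrt (d i)" "R * R *\<^sub>v col U i = (sqrt (d i))\<^sup>2 \<cdot>\<^sub>v col U i"
      using that eigenvector_col eigenvalue_nonneg by simp_all
  qed
  then have "col (B * U) i = col (C * U) i" if "i < n" for i
    using that B C col_mult2[OF carr(1) U that] col_mult2[OF carr(2) U that] by simp
  then have BU: "B * U = C * U"
    using carr U by (intro mat_col_eqI) auto
  have cancel: "R = R * U * U\<^sup>T" if "R \<in> carrier_mat n n" for R
    using that U orthogonal_transpose assoc_mult_mat[of R n n U n "U\<^sup>T" n] by simp
  show ?thesis
    using cancel[OF carr(1)] cancel[OF carr(2)] unfolding BU by (rule trans[OF _ sym])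
qed

lemma psd_sqrt_exists:
  obtains R where "psd n R" "R * R = A"
proof -
  define E where "E = mat_diag n (\<lambda>i. sqrt (d i))"
  define R where "R = U * E * U\<^sup>T"
  have E: "E \<in> carrier_mat n n"
    by (simp add: E_def)
  have R: "R \<in> carrier_mat n n"
    using U E by (simp add: R_def)
  have "R * R = U * E * (U\<^sup>T * U) * E * U\<^sup>T"
    using U E by (simp add: R_def assoc_mult_mat[of _ n n _ n _ n])
  also have "\<dots> = U * (E * E) * U\<^sup>T"
    unfolding UU using U E by (simp add: assoc_mult_mat[of _ n n _ n _ n])
  also have "E * E = mat_diag n d"
    unfolding E_def mat_diag_diag using eigenvalue_nonneg by (auto simp: mat_diag_def)
  finally have RR: "R * R = A"
    using decomp by simp
  have "E\<^sup>T = E"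
    by (auto simp: E_def mat_diag_def)
  then have "R\<^sup>T = R"
    using U E by (simp add: R_def transpose_mult[of _ n n _ n])
  moreover have "0 \<le> x \<bullet> (R *\<^sub>v x)" if x: "x \<in> carrier_vec n" for x
  proof -
    let ?y = "U\<^sup>T *\<^sub>v x"
    have y: "?y \<in> carrier_vec n"
      using U x by simp
    have "x \<bullet> (R *\<^sub>v x) = ?y \<bullet> (E *\<^sub>v ?y)"
      using U E x y scalar_prod_mult_mat_vec[OF U x, of "E *\<^sub>v ?y"]
        assoc_mult_mat_vec[of "U * E" n n "U\<^sup>T" n x] assoc_mult_mat_vec[of U n n E n ?y]
      by (simp add: R_def del: assoc_mult_mat assoc_mult_mat_vec)
    also have "E *\<^sub>v ?y = vec n (\<lambda>i. sqrt (d i) * ?y $ i)"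
    proof (rule eq_vecI)
      fix i assume "i < dim_vec (vec n (\<lambda>i. sqrt (d i) * ?y $ i))"
      then have i: "i < n"
        by simp
      then have "row E i = sqrt (d i) \<cdot>\<^sub>v unit_vec n i"
        by (auto simp: E_def mat_diag_def)
      then show "(E *\<^sub>v ?y) $ i = vec n (\<lambda>i. sqrt (d i) * ?y $ i) $ i"
        using i E scalar_prod_left_unit[OF y i] smult_scalar_prod_distrib[OF unit_vec_carrier y]
        by simp
    qed (use E in simp)
    also have "?y \<bullet> \<dots> = (\<Sum>i = 0..<n. sqrt (d i) * (?y $ i)\<^sup>2)"
      using y by (simp add: scalar_prod_def power2_eq_square mult_ac)
    also have "\<dots> \<ge> 0"
      using eigenvalue_nonneg by (intro sum_nonneg) auto
    finally show ?thesis .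
  qed
  ultimately have "psd n R"
    using R by (simp add: psd_def)
  with RR show ?thesis
    by (intro that)
qed

lemma psd_sqrt_psd: "psd n (psd_sqrt A)"
  and psd_sqrt_square: "psd_sqrt A * psd_sqrt A = A"
proof -
  have n: "dim_row A = n"
    using A by (auto simp: psd_def)
  obtain R where "psd n R \<and> R * R = A"
    using psd_sqrt_exists by blast
  then have "psd n (psd_sqrt A) \<and> psd_sqrt A * psd_sqrt A = A"
    unfolding psd_sqrt_def n by (rule theI) (use psd_sqrt_unique \<open>psd n R \<and> R * R = A\<close> in blast)
  then show "psd n (psd_sqrt A)" "psd_sqrt A * psd_sqrt A = A"
    by auto
qed

end

section \<open>The projection residual\<close>

lemma col_proj_carrier: "M \<in> carrier_mat m n \<Longrightarrow> col_proj M \<in> carrier_mat m m"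
  using pinv_carrier[of M m n] mult_carrier_mat[of M m n "pinv M" m] by (simp add: col_proj_def)

lemma col_proj_transpose: "(col_proj M)\<^sup>T = col_proj M"
  using transpose_mult_pinv[of M "dim_row M" "dim_col M"] by (simp add: col_proj_def)

lemma col_proj_mult: "M \<in> carrier_mat m n \<Longrightarrow> col_proj M * M = M"
  using mult_pinv_mult[of M m n] by (simp add: col_proj_def)

lemma col_proj_idem:
  assumes M: "M \<in> carrier_mat m n"
  shows "col_proj M * col_proj M = col_proj M"
  using assoc_mult_mat[OF col_proj_carrier[OF M] M pinv_carrier[OF M], symmetric]
  unfolding col_proj_mult[OF M] col_proj_def[symmetric] .

text \<open>Pythagoras: \<open>P z\<close> and \<open>z - P z\<close> are orthogonal.\<close>

lemma vec_norm2_complement_projection_le: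
  fixes P :: "real mat"
  assumes P: "P \<in> carrier_mat n n" and sym: "P\<^sup>T = P" and idem: "P * P = P"
    and z: "z \<in> carrier_vec n"
  shows "vec_norm2 ((1\<^sub>m n - P) *\<^sub>v z) \<le> vec_norm2 z"
proof (rule power2_le_imp_le)
  let ?p = "P *\<^sub>v z"
  have p: "?p \<in> carrier_vec n"
    using P z by simp
  have "P *\<^sub>v ?p = ?p"
    using P z idem assoc_mult_mat_vec[OF P P z] by simp
  then have zp: "z \<bullet> ?p = ?p \<bullet> ?p"
    using scalar_prod_mult_mat_vec[OF P z p] sym by simp
  have "(1\<^sub>m n - P) *\<^sub>v z = z - ?p"
    using P z by (simp add: minus_mult_distrib_mat_vec[of _ n n])
  moreover have "(z - ?p) \<bullet> (z - ?p) = z \<bullet> z - ?p \<bullet> ?p"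
    using z p by (simp add: minus_scalar_prod_distrib[of _ n] scalar_prod_minus_distrib[of _ n]
        comm_scalar_prod[of ?p n z] zp)
  ultimately show "(vec_norm2 ((1\<^sub>m n - P) *\<^sub>v z))\<^sup>2 \<le> (vec_norm2 z)\<^sup>2"
    using scalar_prod_self_nonneg[of ?p] by (simp add: vec_norm2_square)
qed simp

text \<open>The error of the Nystrom extension of \<open>A = B\<^sup>2\<close> is \<open>B (1 - P) B\<close> with \<open>P\<close> the projection onto the
  column space of \<open>B S\<close>; the symmetric idempotent \<open>1 - P\<close> splits as a product with itself.\<close>
lemma nystrom_residual_gram:
  fixes B S :: "real mat"
  assumes B: "B \<in> carrier_mat n n" and BT: "B\<^sup>T = B" and S: "S \<in> carrier_mat n l"
  defines "E \<equiv> (1\<^sub>m n - col_proj (B * S)) * B"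
  shows "B * B - B * B * S * pinv (S\<^sup>T * (B * B) * S) * (B * B * S)\<^sup>T = E\<^sup>T * E"
proof -
  define Y where "Y = B * S"
  define P where "P = col_proj Y"
  have Y: "Y \<in> carrier_mat n l"
    using B S by (simp add: Y_def)
  have P: "P \<in> carrier_mat n n" and PT: "P\<^sup>T = P" and PP: "P * P = P"
    using Y col_proj_carrier col_proj_transpose col_proj_idem by (auto simp: P_def)
  note X = pinv_carrier[OF Y]
  define Q where "Q = 1\<^sub>m n - P"
  have Q: "Q \<in> carrier_mat n n"
    unfolding Q_def using P by (rule minus_carrier_mat)
  have QT: "Q\<^sup>T = Q"
    using P PT by (simp add: Q_def transpose_minus[of _ n n])
  have QQ: "Q * Q = Q"
  proof -
    have "Q * Q = Q - P * Q"
      using P Q minus_mult_distrib_mat[of "1\<^sub>m n" n n P Q n] by (simp add: Q_def)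
    also have "P * Q = P - P"
      using P PP by (simp add: Q_def mult_minus_distrib_mat[of _ n n _ n])
    finally show ?thesis
      using P Q by auto
  qed
  have YT: "Y\<^sup>T = S\<^sup>T * B"
    using B S BT by (simp add: Y_def transpose_mult[of _ n n _ l])
  have "S\<^sup>T * (B * B) * S = Y\<^sup>T * Y"
    unfolding YT unfolding Y_def using B S assoc_mult_mat[of "S\<^sup>T" l n B n "B * S" l]
      assoc_mult_mat[of "S\<^sup>T" l n "B * B" n S l] by simp
  moreover have BBS: "B * B * S = B * Y"
    using B S by (simp add: Y_def)
  moreover have "(B * Y)\<^sup>T = Y\<^sup>T * B"
    using B Y BT by (simp add: transpose_mult[of _ n n _ l])
  ultimately have "B * B * S * pinv (S\<^sup>T * (B * B) * S) * (B * B * S)\<^sup>T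
      = B * Y * pinv (Y\<^sup>T * Y) * (Y\<^sup>T * B)"
    by simp
  also have "\<dots> = B * (Y * (pinv (Y\<^sup>T * Y) * Y\<^sup>T)) * B"
  proof -
    let ?V = "pinv (Y\<^sup>T * Y)"
    have V: "?V \<in> carrier_mat l l"
      using Y by (intro pinv_carrier) simp
    have YV: "Y * ?V \<in> carrier_mat n l" and YTB: "Y\<^sup>T * B \<in> carrier_mat l n"
      using B Y V by (auto intro: mult_carrier_mat[of _ _ l] mult_carrier_mat[of _ _ n])
    have VY: "?V * Y\<^sup>T \<in> carrier_mat l n" and YVY: "Y * (?V * Y\<^sup>T) \<in> carrier_mat n n"
      using Y V by (auto intro!: mult_carrier_mat[of _ _ l])
    show ?thesis
      using B Y V assoc_mult_mat[OF B YVY B] assoc_mult_mat[OF Y VY B]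
        assoc_mult_mat[OF B YV YTB] assoc_mult_mat[OF Y V YTB] by simp
  qed
  also have "\<dots> = B * P * B"
    by (simp add: P_def col_proj_def pinv_gram[OF Y, symmetric])
  finally have "B * B - B * B * S * pinv (S\<^sup>T * (B * B) * S) * (B * B * S)\<^sup>T = B * B - B * P * B"
    by simp
  also have "\<dots> = B * (Q * B)"
    using B P by (simp add: Q_def minus_mult_distrib_mat[of _ n n _ _ n]
        mult_minus_distrib_mat[of _ n n _ n])
  also have "\<dots> = B * Q * (Q * B)"
    using B Q QQ assoc_mult_mat[of Q n n Q n B n] assoc_mult_mat[of B n n Q n "Q * B" n] by simp
  also have "\<dots> = E\<^sup>T * E"
    using B Q BT QT by (simp add: E_def Y_def[symmetric] P_def[symmetric] Q_def[symmetric]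
        transpose_mult[of _ n n _ n])
  finally show ?thesis .
qed

lemma transpose_append_cols:
  assumes "M \<in> carrier_mat n k" "N \<in> carrier_mat n j"
  shows "(append_cols M N)\<^sup>T = M\<^sup>T @\<^sub>r N\<^sup>T"
  using assms by (simp add: append_cols_def append_rows_def
      transpose_four_block_mat[of M n k N j _ 0])

text \<open>Cauchy--Schwarz for the vectors \<open>(1, f)\<close> and \<open>(a, b)\<close>.\<close>
lemma square_sum_le:
  fixes a b f :: real
  shows "(a + f * b)\<^sup>2 \<le> (1 + f\<^sup>2) * (a\<^sup>2 + b\<^sup>2)"
proof -
  have "(1 + f\<^sup>2) * (a\<^sup>2 + b\<^sup>2) - (a + f * b)\<^sup>2 = (f * a - b)\<^sup>2"
    by (simp add: power2_eq_square algebra_simps)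
  then show ?thesis
    by (metis diff_ge_0_iff_ge zero_le_power2)
qed

text \<open>The residual \<open>(1 - P) B x\<close> is unchanged when a vector \<open>S y\<close> is subtracted from \<open>x\<close>.  The vector
  \<open>y = \<Omega>\<^sub>1\<^sup>\<dagger> U\<^sub>1\<^sup>T x\<close> is chosen so that the difference \<open>w\<close> is orthogonal to the columns of
  \<open>U\<^sub>1\<close>; the quadratic form \<open>w \<bullet> B\<^sup>2 w\<close> then sees only the block \<open>\<Sigma>\<^sub>2\<close>.\<close>
lemma projection_residual_norm_le:
  fixes B S U\<^sub>1 U\<^sub>2 \<Sigma>\<^sub>1 \<Sigma>\<^sub>2 :: "real mat"
  assumes B: "B \<in> carrier_mat n n" and BT: "B\<^sup>T = B"
    and S: "S \<in> carrier_mat n l"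
    and U1: "U\<^sub>1 \<in> carrier_mat n k" and U2: "U\<^sub>2 \<in> carrier_mat n j"
    and S1: "\<Sigma>\<^sub>1 \<in> carrier_mat k k" and S2: "\<Sigma>\<^sub>2 \<in> carrier_mat j j"
    and orth: "append_cols U\<^sub>1 U\<^sub>2 * (append_cols U\<^sub>1 U\<^sub>2)\<^sup>T = 1\<^sub>m n"
    and BB: "B * B = append_cols U\<^sub>1 U\<^sub>2
           * four_block_mat \<Sigma>\<^sub>1 (0\<^sub>m k j) (0\<^sub>m j k) \<Sigma>\<^sub>2 * (append_cols U\<^sub>1 U\<^sub>2)\<^sup>T"
    and rank: "vec_space.rank k (U\<^sub>1\<^sup>T * S) = k"
  shows "(spectral_norm ((1\<^sub>m n - col_proj (B * S)) * B))\<^sup>2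
           \<le> spectral_norm \<Sigma>\<^sub>2 * (1 + (spectral_norm (U\<^sub>2\<^sup>T * S * pinv (U\<^sub>1\<^sup>T * S)))\<^sup>2)"
proof -
  define U where "U = append_cols U\<^sub>1 U\<^sub>2"
  define D where "D = four_block_mat \<Sigma>\<^sub>1 (0\<^sub>m k j) (0\<^sub>m j k) \<Sigma>\<^sub>2"
  define Q where "Q = 1\<^sub>m n - col_proj (B * S)"
  define O1 where "O1 = U\<^sub>1\<^sup>T * S"
  define O2 where "O2 = U\<^sub>2\<^sup>T * S"
  define F where "F = O2 * pinv O1"
  let ?s = "spectral_norm \<Sigma>\<^sub>2" and ?f = "spectral_norm F"
  have U: "U \<in> carrier_mat n (k + j)"
    using U1 U2 by (auto simp: U_def append_cols_def)
  have D: "D \<in> carrier_mat (k + j) (k + j)"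
    using S1 S2 by (auto simp: D_def)
  have O1: "O1 \<in> carrier_mat k l" and O2: "O2 \<in> carrier_mat j l"
    using U1 U2 S by (auto simp: O1_def O2_def)
  note V = pinv_carrier[OF O1]
  have F: "F \<in> carrier_mat j k"
    using O2 V by (simp add: F_def)
  have O1V: "O1 * pinv O1 = 1\<^sub>m k"
    using mult_pinv_full_row_rank[OF O1] rank by (simp add: O1_def)
  have Y: "B * S \<in> carrier_mat n l"
    using B S by simp
  note P = col_proj_carrier[OF Y]
  have Q: "Q \<in> carrier_mat n n"
    unfolding Q_def using P by (rule minus_carrier_mat)
  have QBS: "Q * B * S = 0\<^sub>m n l"
  proof -
    have "Q * B * S = Q * (B * S)"
      using Q B S by simp
    also have "\<dots> = B * S - B * S"
      unfolding Q_def using P Y col_proj_mult[OF Y] left_mult_one_mat[OF Y]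
      by (simp add: minus_mult_distrib_mat[of _ n n _ _ l] del: assoc_mult_mat)
    finally show ?thesis
      using Y by simp
  qed
  have s0: "0 \<le> ?s" and f0: "0 \<le> ?f"
    using spectral_norm_nonneg[OF S2] spectral_norm_nonneg[OF F] by auto
  have UT: "U\<^sup>T *\<^sub>v x = (U\<^sub>1\<^sup>T *\<^sub>v x) @\<^sub>v (U\<^sub>2\<^sup>T *\<^sub>v x)" if "x \<in> carrier_vec n" for x
    unfolding U_def transpose_append_cols[OF U1 U2] using U1 U2 that
    by (intro mat_mult_append[of _ k n _ j]) auto
  have bound: "(vec_norm2 (Q * B *\<^sub>v x))\<^sup>2 \<le> ?s * (1 + ?f\<^sup>2) * (vec_norm2 x)\<^sup>2"
    if x: "x \<in> carrier_vec n" for x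
  proof -
    define x1 where "x1 = U\<^sub>1\<^sup>T *\<^sub>v x"
    define x2 where "x2 = U\<^sub>2\<^sup>T *\<^sub>v x"
    define y where "y = pinv O1 *\<^sub>v x1"
    define w where "w = x - S *\<^sub>v y"
    have x1: "x1 \<in> carrier_vec k" and x2: "x2 \<in> carrier_vec j"
      using U1 U2 x by (auto simp: x1_def x2_def)
    have y: "y \<in> carrier_vec l"
      using V x1 by (simp add: y_def)
    have w: "w \<in> carrier_vec n"
      using S x y by (simp add: w_def)
    \<comment> \<open>\<open>U\<^sup>T\<close> is an isometry\<close>
    have pythagoras: "(vec_norm2 x)\<^sup>2 = (vec_norm2 x1)\<^sup>2 + (vec_norm2 x2)\<^sup>2"
    proof -
      have "x \<bullet> x = x \<bullet> (U *\<^sub>v (U\<^sup>T *\<^sub>v x))"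
        using orth U x assoc_mult_mat_vec[of U n "k + j" "U\<^sup>T" n x] by (simp add: U_def)
      also have "\<dots> = (U\<^sup>T *\<^sub>v x) \<bullet> (U\<^sup>T *\<^sub>v x)"
        using U x by (intro scalar_prod_mult_mat_vec[of _ n "k + j"]) auto
      also have "\<dots> = x1 \<bullet> x1 + x2 \<bullet> x2"
        unfolding UT[OF x] x1_def[symmetric] x2_def[symmetric] using x1 x2
        by (intro scalar_prod_append) auto
      finally show ?thesis
        by (simp add: vec_norm2_square)
    qed
    have "Q * B *\<^sub>v w = Q * B *\<^sub>v x - Q * B *\<^sub>v (S *\<^sub>v y)"
      unfolding w_def using Q B S x y by (intro mult_minus_distrib_mat_vec[of _ n n]) auto
    also have "Q * B *\<^sub>v (S *\<^sub>v y) = Q * B * S *\<^sub>v y"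
      using Q B S y by (intro assoc_mult_mat_vec[of _ n n _ l, symmetric]) auto
    also have "\<dots> = 0\<^sub>v n"
      unfolding QBS using y by (intro eq_vecI) (auto simp: scalar_prod_def)
    finally have "Q * B *\<^sub>v x = Q *\<^sub>v (B *\<^sub>v w)"
      using Q B x w by simp
    then have "(vec_norm2 (Q * B *\<^sub>v x))\<^sup>2 \<le> (vec_norm2 (B *\<^sub>v w))\<^sup>2"
      using vec_norm2_complement_projection_le[OF P col_proj_transpose col_proj_idem[OF Y],
          of "B *\<^sub>v w"] B w by (simp add: Q_def power_mono)
    also have "\<dots> = w \<bullet> (B * B *\<^sub>v w)"
      using vec_norm2_mult_square[OF B w] BT by simp
    also have "B * B *\<^sub>v w = U *\<^sub>v (D *\<^sub>v (U\<^sup>T *\<^sub>v w))"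
      unfolding BB U_def[symmetric] D_def[symmetric] 
      using U D w assoc_mult_mat_vec[of "U * D" n "k + j" "U\<^sup>T" n w]
        assoc_mult_mat_vec[of U n "k + j" D "k + j" "U\<^sup>T *\<^sub>v w"]
      by (simp del: assoc_mult_mat assoc_mult_mat_vec)
    also have "w \<bullet> \<dots> = (U\<^sup>T *\<^sub>v w) \<bullet> (D *\<^sub>v (U\<^sup>T *\<^sub>v w))"
      using U D w by (intro scalar_prod_mult_mat_vec[of _ n "k + j"]) auto
    also have "U\<^sup>T *\<^sub>v w = 0\<^sub>v k @\<^sub>v (x2 - F *\<^sub>v x1)"
    proof -
      have "U\<^sub>1\<^sup>T *\<^sub>v w = x1 - O1 *\<^sub>v y"
        using U1 S x y unfolding w_def x1_def O1_def
        by (simp add: mult_minus_distrib_mat_vec[of _ k n])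
      moreover have "O1 *\<^sub>v y = x1"
        unfolding y_def using O1 V x1 O1V assoc_mult_mat_vec[OF O1 V x1] by simp
      moreover have "U\<^sub>2\<^sup>T *\<^sub>v w = x2 - O2 *\<^sub>v y"
        using U2 S x y unfolding w_def x2_def O2_def
        by (simp add: mult_minus_distrib_mat_vec[of _ j n])
      moreover have "O2 *\<^sub>v y = F *\<^sub>v x1"
        unfolding y_def F_def using O2 V x1 by simp
      ultimately show ?thesis
        using UT[OF w] x1 by simp
    qed
    also have "D *\<^sub>v (0\<^sub>v k @\<^sub>v (x2 - F *\<^sub>v x1)) = 0\<^sub>v k @\<^sub>v (\<Sigma>\<^sub>2 *\<^sub>v (x2 - F *\<^sub>v x1))"
    proof -
      have "x2 - F *\<^sub>v x1 \<in> carrier_vec j"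
        using x2 F x1 by simp
      moreover have "\<Sigma>\<^sub>1 *\<^sub>v 0\<^sub>v k = 0\<^sub>v k"
        using S1 by auto
      ultimately show ?thesis
        unfolding D_def using S1 S2
        by (subst four_block_mat_mult_vec[of _ k k _ j _ j]) auto
    qed
    also have "(0\<^sub>v k @\<^sub>v (x2 - F *\<^sub>v x1)) \<bullet> (0\<^sub>v k @\<^sub>v (\<Sigma>\<^sub>2 *\<^sub>v (x2 - F *\<^sub>v x1)))
        = (x2 - F *\<^sub>v x1) \<bullet> (\<Sigma>\<^sub>2 *\<^sub>v (x2 - F *\<^sub>v x1))" (is "_ = ?v \<bullet> _")
      using x2 x1 F S2 by (subst scalar_prod_append[of _ k _ j]) auto
    also have "\<dots> \<le> vec_norm2 ?v * vec_norm2 (\<Sigma>\<^sub>2 *\<^sub>v ?v)"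
      using x1 x2 F S2 by (intro scalar_prod_le_vec_norm2[of _ j]) auto
    also have "\<dots> \<le> vec_norm2 ?v * (?s * vec_norm2 ?v)"
      using x1 x2 F by (intro mult_left_mono vec_norm2_mult_le[OF S2]) auto
    also have "\<dots> = ?s * (vec_norm2 ?v)\<^sup>2"
      by (simp add: power2_eq_square)
    also have "\<dots> \<le> ?s * ((1 + ?f\<^sup>2) * (vec_norm2 x)\<^sup>2)"
    proof (intro mult_left_mono s0)
      have "vec_norm2 ?v \<le> vec_norm2 x2 + vec_norm2 (F *\<^sub>v x1)"
        using x1 x2 F by (intro vec_norm2_minus_le[of _ j]) auto
      also have "\<dots> \<le> vec_norm2 x2 + ?f * vec_norm2 x1"
        using vec_norm2_mult_le[OF F x1] by simp
      finally have "(vec_norm2 ?v)\<^sup>2 \<le> (vec_norm2 x2 + ?f * vec_norm2 x1)\<^sup>2"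
        by (intro power_mono) auto
      also have "\<dots> \<le> (1 + ?f\<^sup>2) * ((vec_norm2 x2)\<^sup>2 + (vec_norm2 x1)\<^sup>2)"
        by (rule square_sum_le)
      finally show "(vec_norm2 ?v)\<^sup>2 \<le> (1 + ?f\<^sup>2) * (vec_norm2 x)\<^sup>2"
        unfolding pythagoras by (simp add: add.commute)
    qed
    finally show ?thesis
      by (simp add: mult.assoc)
  qed
  let ?c = "?s * (1 + ?f\<^sup>2)"
  have c0: "0 \<le> ?c"
    using s0 by simp
  have QB: "Q * B \<in> carrier_mat n n"
    using Q B by simp
  have "spectral_norm (Q * B) \<le> sqrt ?c"
  proof (rule spectral_norm_le[OF QB])
    fix x :: "real vec"
    assume x: "x \<in> carrier_vec n"
    have "(vec_norm2 (Q * B *\<^sub>v x))\<^sup>2 \<le> (sqrt ?c * vec_norm2 x)\<^sup>2"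
      using bound[OF x] c0 by (simp add: power_mult_distrib)
    then show "vec_norm2 (Q * B *\<^sub>v x) \<le> sqrt ?c * vec_norm2 x"
      by (rule power2_le_imp_le) (simp add: c0)
  qed (simp add: c0)
  then have "(spectral_norm (Q * B))\<^sup>2 \<le> (sqrt ?c)\<^sup>2"
    using spectral_norm_nonneg[OF QB] by (rule power_mono)
  then show ?thesis
    using c0 by (simp add: Q_def F_def O1_def O2_def)
qed

section \<open>The error bound\<close>

theorem theorem1:
  fixes n k l :: nat
    and A S U\<^sub>1 U\<^sub>2 \<Sigma>\<^sub>1 \<Sigma>\<^sub>2 \<Omega>\<^sub>1 \<Omega>\<^sub>2 C W :: "real mat"
  assumes "psd n A"
    and "1 \<le> k" and "k \<le> n"
    and "S \<in> carrier_mat n l"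
    and "U\<^sub>1 \<in> carrier_mat n k"
    and "U\<^sub>2 \<in> carrier_mat n (n - k)"
    and "(append_cols U\<^sub>1 U\<^sub>2)\<^sup>T * append_cols U\<^sub>1 U\<^sub>2 = 1\<^sub>m n"
    and "\<Sigma>\<^sub>1 = mat_diag k (\<lambda>i. eigenvalues_desc A ! i)"
    and "\<Sigma>\<^sub>2 = mat_diag (n - k) (\<lambda>i. eigenvalues_desc A ! (k + i))"
    and "A = append_cols U\<^sub>1 U\<^sub>2
           * four_block_mat \<Sigma>\<^sub>1 (0\<^sub>m k (n - k)) (0\<^sub>m (n - k) k) \<Sigma>\<^sub>2
           * (U\<^sub>1\<^sup>T @\<^sub>r U\<^sub>2\<^sup>T)"
    and "\<Omega>\<^sub>1 = U\<^sub>1\<^sup>T * S"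
    and "\<Omega>\<^sub>2 = U\<^sub>2\<^sup>T * S"
    and "C = A * S"
    and "W = S\<^sup>T * A * S"
    and "vec_space.rank k \<Omega>\<^sub>1 = k"
  shows "spectral_norm (A - C * pinv W * C\<^sup>T)
           = (spectral_norm ((1\<^sub>m n - col_proj (psd_sqrt A * S)) * psd_sqrt A))\<^sup>2
       \<and> (spectral_norm ((1\<^sub>m n - col_proj (psd_sqrt A * S)) * psd_sqrt A))\<^sup>2
           \<le> spectral_norm \<Sigma>\<^sub>2 * (1 + (spectral_norm (\<Omega>\<^sub>2 * pinv \<Omega>\<^sub>1))\<^sup>2)"
proof -
  note psd = assms(1) and S = assms(4) and U1 = assms(5) and U2 = assms(6) and orth = assms(7)
  define U where "U = append_cols U\<^sub>1 U\<^sub>2"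
  have "append_cols U\<^sub>1 U\<^sub>2 \<in> carrier_mat (n + 0) (k + (n - k))"
    unfolding append_cols_def using U1 U2 by (intro four_block_carrier_mat) auto
  then have U: "U \<in> carrier_mat n n"
    using assms(3) by (simp add: U_def)
  \<comment> \<open>\<open>eigenvalues_desc A\<close> splits at index \<open>k\<close>, so the two blocks form one diagonal matrix\<close>
  have blocks: "four_block_mat \<Sigma>\<^sub>1 (0\<^sub>m k (n - k)) (0\<^sub>m (n - k) k) \<Sigma>\<^sub>2
      = mat_diag n (\<lambda>i. eigenvalues_desc A ! i)"
    unfolding assms(8,9) using assms(3) by (intro eq_matI) (auto simp: mat_diag_def)
  have decomp: "A = U * four_block_mat \<Sigma>\<^sub>1 (0\<^sub>m k (n - k)) (0\<^sub>m (n - k) k) \<Sigma>\<^sub>2 * U\<^sup>T"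
    using assms(10) transpose_append_cols[OF U1 U2] by (simp add: U_def)
  note diagonalization = psd U orth[folded U_def] decomp[unfolded blocks]
  define B where "B = psd_sqrt A"
  have BB: "B * B = A"
    unfolding B_def by (rule psd_sqrt_square[OF diagonalization])
  have "psd n B"
    unfolding B_def by (rule psd_sqrt_psd[OF diagonalization])
  then have B: "B \<in> carrier_mat n n" and BT: "B\<^sup>T = B"
    by (auto simp: psd_def)
  let ?E = "(1\<^sub>m n - col_proj (B * S)) * B"
  have "?E \<in> carrier_mat n n"
    using B S col_proj_carrier[of "B * S" n l] by auto
  moreover have "A - C * pinv W * C\<^sup>T = ?E\<^sup>T * ?E"
    using nystrom_residual_gram[OF B BT S] unfolding BB assms(13,14) .
  ultimately have eq: "spectral_norm (A - C * pinv W * C\<^sup>T) = (spectral_norm ?E)\<^sup>2"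
    using spectral_norm_gram by simp
  have le: "(spectral_norm ?E)\<^sup>2
      \<le> spectral_norm \<Sigma>\<^sub>2 * (1 + (spectral_norm (\<Omega>\<^sub>2 * pinv \<Omega>\<^sub>1))\<^sup>2)"
    unfolding assms(11,12)
  proof (rule projection_residual_norm_le[OF B BT S U1 U2])
    show "\<Sigma>\<^sub>1 \<in> carrier_mat k k" "\<Sigma>\<^sub>2 \<in> carrier_mat (n - k) (n - k)"
      unfolding assms(8,9) by simp_all
    show "append_cols U\<^sub>1 U\<^sub>2 * (append_cols U\<^sub>1 U\<^sub>2)\<^sup>T = 1\<^sub>m n"
      using orthogonal_transpose[OF diagonalization] by (simp add: U_def)
    show "B * B = append_cols U\<^sub>1 U\<^sub>2
        * four_block_mat \<Sigma>\<^sub>1 (0\<^sub>m k (n - k)) (0\<^sub>m (n - k) k) \<Sigma>\<^sub>2 * (append_cols U\<^sub>1 U\<^sub>2)\<^sup>T"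
      unfolding BB using decomp by (simp add: U_def)
    show "vec_space.rank k (U\<^sub>1\<^sup>T * S) = k"
      using assms(11,15) by simp
  qed
  show ?thesis
    using eq le by (simp add: B_def)
qed

end
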